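(* Let $N,K\ge1$ and let $X_1,\ldots,X_K\in\mathbb{C}_{\le N-1}[z]$ be not all identically zero, with $\Gamma_{ij}(z)=X_i(z)\widetilde{X}_j(z)$. Let $Q=\gcd\{X_1,\ldots,X_K\}\in\mathbb{C}_{\le D}[z]$ and let $R_1,\ldots,R_K\in\mathbb{C}_{\le N-D-1}[z]$ be the quotients, $X_k=QR_k$. Suppose that the root structure of $H(z)=Q(z)\widetilde{Q}(z)\in\mathbb{C}_{\le 2D}[z]$ is as follows: $H$ has $P$ (distinct) root pairs $(\delta_1,\overline{\delta}_1^{-1}),\ldots,(\delta_P,\overline{\delta}_P^{-1})$ outside the unit circle, with multiplicities $\mu_1,\ldots,\mu_P$, and (distinct) roots $\varepsilon_1,\ldots,\varepsilon_T\in\mathbb{T}$ with (even) multiplicities $\nu_1,\ldots,\nu_T$. Then all the possible factorizations, i.e. all tuples $Y_1,\ldots,Y_K\in\mathbb{C}_{\le N-1}[z]$ with $\Gamma_{ij}(z)=Y_i(z)\widetilde{Y}_j(z)$ for all $i,j$, are given by $$Y_k(z)=\beta S(z)R_k(z),\qquad k=1,\ldots,K,$$ where $\beta\in\mathbb{T}$ is arbitrary and $$S(z)=\lambda\prod_{i=1}^{P}(z-\delta_i)^{\ell_i}(z-\overline{\delta}_i^{-1})^{\mu_i-\ell_i}\prod_{j=1}^{T}(z-\varepsilon_j)^{\nu_j/2},$$ with integers $0\le\ell_i\le\mu_i$, and $\lambda>0$ a constant that depends on the particular collection $(\ell_1,\ldots,\ell_P)$.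
   Context: $\mathbb{T} = \{z\in\mathbb{C} : |z|=1\}$. $\mathbb{C}_{\le D}[z]$ is the $(D+1)$-dimensional space of complex univariate polynomials of degree at most $D$; a polynomial is always considered together with the space (degree bound) it belongs to. For $A(z)=\sum_{n=0}^{D} a[n]z^n \in \mathbb{C}_{\le D}[z]$, the conjugate reversal is $\widetilde{A}(z) = z^{D}\,\overline{A(\overline{z}^{-1})} = \sum_{n=0}^{D}\overline{a[D-n]}z^n \in \mathbb{C}_{\le D}[z]$. Multiplication is the map $\mathbb{C}_{\le D_1}[z]\times\mathbb{C}_{\le D_2}[z]\to\mathbb{C}_{\le D_1+D_2}[z]$. Roots: $A\in\mathbb{C}_{\le D}[z]\setminus\{0\}$ has a root at $\infty$ of multiplicity $\mu$ if exactly its $\mu$ leading coefficients $a[D],\ldots,a[D-\mu+1]$ vanish. Formally $(z-\infty):=0\cdot z+1\in\mathbb{C}_{\le1}[z]$, so multiplying by $(z-\infty)^d$ appends $d$ zero leading coefficients. Every nonzero $A\in\mathbb{C}_{\le D}[z]$ factors uniquely as $\lambda\prod_i(z-\alpha_i)^{\mu_i}$ with distinct $\alpha_i\in\mathbb{C}\cup\{\infty\}$ and $\sum_i\mu_i=D$. Conventions: $0^{-1}=\infty$, $\infty^{-1}=0$, $\overline{\infty}=\infty$. Root pairs: if $\delta\in(\mathbb{C}\cup\{\infty\})\setminus\mathbb{T}$ is a root of $H=Q\widetilde Q$ with multiplicity $\mu$ then $\overline{\delta}^{-1}$ is also a root with the same multiplicity $\mu$, and the pair $(\delta,\overline{\delta}^{-1})$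 is called a root pair of multiplicity $\mu$ (each pair is listed once). Roots of $H$ in $\mathbb{T}$ have even multiplicity. Divisibility: $C\in\mathbb{C}_{\le M}[z]$ has a divisor $B\in\mathbb{C}_{\le D}[z]\setminus\{0\}$ if there is $A\in\mathbb{C}_{\le M-D}[z]$ with $C=AB$. The $\gcd$ of a set of polynomials (each in its own space) is the polynomial in $\mathbb{C}_{\le D}[z]$ with highest possible $D$ that divides all of them in this sense (with $\gcd\{A,0\}=A$), defined up to a nonzero scalar; here $Q$ is any fixed choice. *)

theory Defs
  imports Complex_Main "HOL-Library.FuncSet" "HOL-Computational_Algebra.Polynomial"
begin

text \<open>A polynomial considered in the space of polynomials of degree at most D is a
  \<^typ>\<open>complex poly\<close> accompanied by an explicit degree bound D.\<close>

definition poly_space :: "nat \<Rightarrow> complex poly set"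
  where "poly_space D = {A. degree A \<le> D}"

definition conj_rev :: "nat \<Rightarrow> complex poly \<Rightarrow> complex poly"
  where "conj_rev D A = (\<Sum>n\<le>D. monom (cnj (coeff A (D - n))) n)"

definition Gamma :: "nat \<Rightarrow> (nat \<Rightarrow> complex poly) \<Rightarrow> nat \<Rightarrow> nat \<Rightarrow> complex poly"
  where "Gamma N X i j = X i * conj_rev (N - 1) (X j)"

definition space_dvd :: "nat \<Rightarrow> complex poly \<Rightarrow> nat \<Rightarrow> complex poly \<Rightarrow> bool"
  where "space_dvd D B M C \<longleftrightarrow>
    B \<in> poly_space D \<and> B \<noteq> 0 \<and> C \<in> poly_space M \<and> D \<le> M \<and>
    (\<exists>A \<in> poly_space (M - D). C = A * B)"

text \<open>The greatest common divisor of a family of polynomials that all live in degree bound M.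
  It maximises the degree bound D, not the degree, so that common roots at infinity count.
  The zero polynomial is divisible by every nonzero polynomial of bound at most M, hence zero
  members of the family impose no restriction.\<close>

definition is_gcd :: "nat \<Rightarrow> complex poly \<Rightarrow> nat \<Rightarrow> complex poly set \<Rightarrow> bool"
  where "is_gcd D Q M F \<longleftrightarrow>
    (\<forall>C\<in>F. space_dvd D Q M C) \<and>
    (\<forall>D' B. (\<forall>C\<in>F. space_dvd D' B M C) \<longrightarrow> D' \<le> D)"

datatype ecomplex = Fin complex | Infty

definition unit_circle :: "ecomplex set"
  where "unit_circle = {Fin z | z. cmod z = 1}"

fun conj_inv :: "ecomplex \<Rightarrow> ecomplex" where
  "conj_inv (Fin a) = (if a = 0 then Infty else Fin (inverse (cnj a)))"
| "conj_inv Infty = Fin 0"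

text \<open>Only used for nonzero A of degree at most D: then the number of vanishing leading
  coefficients among the D + 1 coefficients is D minus the degree.\<close>

fun root_mult :: "nat \<Rightarrow> complex poly \<Rightarrow> ecomplex \<Rightarrow> nat" where
  "root_mult D A (Fin a) = order a A"
| "root_mult D A Infty = D - degree A"

text \<open>The factor for infinity is 0 z + 1, regarded as having degree bound 1.\<close>

fun lin_factor :: "ecomplex \<Rightarrow> complex poly" where
  "lin_factor (Fin a) = [:- a, 1:]"
| "lin_factor Infty = 1"

text \<open>Each root pair is listed once, through one chosen member. For a product of Q with its
  conjugate reversal, the second member has the same multiplicity as the first, and the
  multiplicities on the unit circle are even; neither fact is assumed here.\<close>

definition root_structure ::
  "nat \<Rightarrow> complex poly \<Rightarrow> nat \<Rightarrow> (nat \<Rightarrow> ecomplex) \<Rightarrow> (nat \<Rightarrow> nat) \<Rightarrow>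
   nat \<Rightarrow> (nat \<Rightarrow> complex) \<Rightarrow> (nat \<Rightarrow> nat) \<Rightarrow> bool"
  where "root_structure M H P \<delta> \<mu> T \<epsilon> \<nu> \<longleftrightarrow>
    {w. w \<notin> unit_circle \<and> root_mult M H w > 0} = (\<Union>i\<in>{1..P}. {\<delta> i, conj_inv (\<delta> i)}) \<and>
    (\<forall>i\<in>{1..P}. \<forall>i'\<in>{1..P}. i \<noteq> i' \<longrightarrow> \<delta> i \<noteq> \<delta> i' \<and> \<delta> i \<noteq> conj_inv (\<delta> i')) \<and>
    (\<forall>i\<in>{1..P}. root_mult M H (\<delta> i) = \<mu> i) \<and>
    {w. w \<in> unit_circle \<and> root_mult M H w > 0} = (\<lambda>j. Fin (\<epsilon> j)) ` {1..T} \<and>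
    inj_on \<epsilon> {1..T} \<and>
    (\<forall>j\<in>{1..T}. root_mult M H (Fin (\<epsilon> j)) = \<nu> j)"

end

theory Submission
  imports
    Defs
    "HOL-Computational_Algebra.Field_as_Ring"
    "HOL-Computational_Algebra.Polynomial_Factorial"
    "HOL-Computational_Algebra.Fundamental_Theorem_Algebra"
begin

text \<open>
  The theorem splits into a divisibility statement about the whole family and a spectral
  factorization problem for the single polynomial \<open>H = Q * conj_rev D Q\<close>.

  Divisibility. The quotients \<open>R k\<close> have no common root, neither in the complex plane nor at
  infinity, because such a root could be moved into \<open>Q\<close> and would give a common divisor of
  bound \<open>D + 1\<close> (\<open>gcd_quotients_no_common_root\<close>). If \<open>Y\<close> has the same correlations as \<open>X\<close>, fix
  an index \<open>j\<close> with \<open>X j \<noteq> 0\<close>. The equations for the pairs \<open>(k, j)\<close> say that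
  \<open>Y k * V = R k * W\<close> with \<open>V\<close> and \<open>W\<close> independent of \<open>k\<close>. As the \<open>R k\<close> are coprime, \<open>V\<close>
  divides \<open>W\<close>, and the quotient \<open>S\<close> satisfies \<open>Y k = S * R k\<close>
  (\<open>proportional_family_factors\<close>). Some \<open>R k\<close> has no root at infinity, hence full degree, so
  \<open>S\<close> has degree at most \<open>D\<close>. Cancelling \<open>R j\<close> and its reversal from the equation for \<open>(j, j)\<close>
  leaves \<open>S * conj_rev D S = H\<close>. Conversely every such \<open>S\<close> gives a solution
  (\<open>same_correlations_iff_spectral_factor\<close>).

  Spectral factorization. With roots at infinity counted, the conjugate reversal moves a root
  \<open>w\<close> to \<open>conj_inv w\<close>. Thus the multiplicity of \<open>w\<close> in \<open>S * conj_rev D S\<close> is the sum of the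
  multiplicities of \<open>w\<close> and \<open>conj_inv w\<close> in \<open>S\<close> (\<open>root_mult_autocorrelation\<close>). If this product
  is \<open>H\<close>, then a root pair of multiplicity \<open>\<mu> i\<close> contributes \<open>l i\<close> copies of one member and
  \<open>\<mu> i - l i\<close> copies of the other member to \<open>S\<close>, and a root on the circle contributes half of
  its multiplicity; this determines \<open>S\<close> up to a scalar (\<open>spectral_factor_is_root_choice\<close>).
  Conversely, reversal turns the choice \<open>l\<close> into the complementary choice, up to a scalar, and
  the product of two complementary choices does not depend on \<open>l\<close>. Since \<open>Q\<close> itself is a
  choice, every choice \<open>F\<close> has \<open>F * conj_rev D F\<close> proportional to \<open>H\<close>. The factor is positive,
  because the middle coefficient of \<open>A * conj_rev D A\<close> is the sum of the squared moduli of the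
  coefficients of \<open>A\<close>. Hence a positive multiple of \<open>F\<close> solves the equation
  (\<open>normalized_root_choice\<close>), and a scalar that preserves the solution lies on the unit circle
  (\<open>spectral_factors\<close>).
\<close>

section \<open>Conjugate reversal\<close>

lemma poly_space_mult:
  assumes "A \<in> poly_space D" "B \<in> poly_space E"
  shows "A * B \<in> poly_space (D + E)"
  using assms degree_mult_le[of A B] by (simp add: poly_space_def)

lemma coeff_conj_rev:
  "coeff (conj_rev D A) n = (if n \<le> D then cnj (coeff A (D - n)) else 0)"
  by (simp add: conj_rev_def coeff_sum)

lemma conj_rev_in_poly_space: "conj_rev D A \<in> poly_space D"
  by (auto simp: poly_space_def coeff_conj_rev intro: degree_le)

lemma conj_rev_conj_rev:
  assumes "A \<in> poly_space D"
  shows "conj_rev D (conj_rev D A) = A"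
  using assms by (intro poly_eqI) (auto simp: coeff_conj_rev poly_space_def coeff_eq_0)

lemma conj_rev_eq_0_iff:
  assumes "A \<in> poly_space D"
  shows "conj_rev D A = 0 \<longleftrightarrow> A = 0"
proof
  assume "conj_rev D A = 0"
  moreover have "conj_rev D 0 = 0" by (simp add: conj_rev_def)
  ultimately show "A = 0" using conj_rev_conj_rev[OF assms] by simp
qed (simp add: conj_rev_def)

lemma conj_rev_smult: "conj_rev D (smult c A) = smult (cnj c) (conj_rev D A)"
  by (rule poly_eqI) (simp add: coeff_conj_rev)

lemma poly_conj_rev:
  assumes "A \<in> poly_space D" "z \<noteq> 0"
  shows "poly (conj_rev D A) z = z ^ D * cnj (poly A (inverse (cnj z)))"
proof -
  have A: "poly A x = (\<Sum>n\<le>D. coeff A n * x ^ n)" for x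
    unfolding poly_altdef using assms(1)
    by (intro sum.mono_neutral_left) (auto simp: poly_space_def coeff_eq_0)
  have "poly (conj_rev D A) z = (\<Sum>n\<le>D. cnj (coeff A (D - n)) * z ^ n)"
    by (simp add: conj_rev_def poly_sum poly_monom)
  also have "\<dots> = (\<Sum>n\<le>D. cnj (coeff A n) * z ^ (D - n))"
    by (rule sum.reindex_bij_witness[of _ "\<lambda>n. D - n" "\<lambda>n. D - n"]) auto
  also have "\<dots> = (\<Sum>n\<le>D. z ^ D * (cnj (coeff A n) * inverse z ^ n))"
    by (rule sum.cong) (auto simp: power_diff assms(2) field_simps)
  also have "\<dots> = z ^ D * cnj (poly A (inverse (cnj z)))"
    by (simp add: A sum_distrib_left)
  finally show ?thesis .
qed

text \<open>By \<open>poly_conj_rev\<close> both sides agree at every nonzero point, and a polynomial with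
  infinitely many roots is zero. This avoids the reindexing of convolution sums.\<close>
lemma conj_rev_mult:
  assumes "A \<in> poly_space D" "B \<in> poly_space E"
  shows "conj_rev (D + E) (A * B) = conj_rev D A * conj_rev E B"
proof -
  let ?p = "conj_rev (D + E) (A * B) - conj_rev D A * conj_rev E B"
  have "poly ?p z = 0" if "z \<noteq> 0" for z
    using assms that poly_space_mult[OF assms]
    by (simp add: poly_conj_rev power_add)
  then have "UNIV - {0} \<subseteq> {z. poly ?p z = 0}" by auto
  moreover have "infinite (UNIV - {0 :: complex})"
    by (simp add: infinite_UNIV_char_0)
  ultimately have "infinite {z. poly ?p z = 0}"
    using finite_subset by blast
  then have "?p = 0" using poly_roots_finite by blast
  then show ?thesis by simp
qed

lemma poly_space_power: "A \<in> poly_space D \<Longrightarrow> A ^ m \<in> poly_space (m * D)"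
proof (induction m)
  case (Suc m)
  then show ?case using poly_space_mult[of A D "A ^ m" "m * D"] by simp
qed (simp add: poly_space_def)

lemma conj_rev_0_1: "conj_rev 0 1 = 1"
  by (rule poly_eqI) (auto simp: coeff_conj_rev)

lemma conj_rev_power:
  "A \<in> poly_space D \<Longrightarrow> conj_rev (m * D) (A ^ m) = conj_rev D A ^ m"
  by (induction m) (simp_all add: conj_rev_0_1 conj_rev_mult poly_space_power)

lemma poly_space_prod:
  assumes "finite I" "\<And>i. i \<in> I \<Longrightarrow> f i \<in> poly_space (d i)"
  shows "(\<Prod>i\<in>I. f i) \<in> poly_space (\<Sum>i\<in>I. d i)"
  using assms
  by (induction I rule: finite_induct) (auto simp: poly_space_mult, simp add: poly_space_def)

lemma conj_rev_prod:
  assumes "finite I" "\<And>i. i \<in> I \<Longrightarrow> f i \<in> poly_space (d i)"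
  shows "conj_rev (\<Sum>i\<in>I. d i) (\<Prod>i\<in>I. f i) = (\<Prod>i\<in>I. conj_rev (d i) (f i))"
  using assms
  by (induction I rule: finite_induct) (simp_all add: conj_rev_0_1 conj_rev_mult poly_space_prod)

text \<open>This identity is the source of all positivity below. On the unit circle,
  \<open>A * conj_rev D A\<close> equals \<open>z ^ D * \<bar>A z\<bar>\<^sup>2\<close>, so its coefficient of index \<open>D\<close> is the mean of
  \<open>\<bar>A z\<bar>\<^sup>2\<close> over the circle, which Parseval expresses through the coefficients.\<close>
lemma coeff_mult_conj_rev_middle:
  "coeff (A * conj_rev D A) D = of_real (\<Sum>n\<le>D. (cmod (coeff A n))\<^sup>2)"
  unfolding of_real_sum coeff_mult by (rule sum.cong) (auto simp: coeff_conj_rev complex_norm_square simp del: of_real_power)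

lemma coeff_mult_conj_rev_middle_pos:
  assumes "A \<in> poly_space D" "A \<noteq> 0"
  shows "\<exists>r>0. coeff (A * conj_rev D A) D = of_real r"
proof -
  have "0 < (\<Sum>n\<le>D. (cmod (coeff A n))\<^sup>2)"
    using assms by (intro sum_pos2[of _ "degree A"]) (auto simp: poly_space_def)
  then show ?thesis unfolding coeff_mult_conj_rev_middle by blast
qed

text \<open>A comparison of the middle coefficients, which are positive, determines \<open>\<kappa>\<close>.\<close>
lemma proportional_autocorrelation_pos:
  assumes "A \<in> poly_space D" "A \<noteq> 0" "B \<in> poly_space D" "B \<noteq> 0"
    and "A * conj_rev D A = smult \<kappa> (B * conj_rev D B)"
  shows "\<exists>r>0. \<kappa> = of_real r"
proof -
  obtain a b where ab: "a > 0" "b > 0" "coeff (A * conj_rev D A) D = of_real a"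
      "coeff (B * conj_rev D B) D = of_real b"
    using assms coeff_mult_conj_rev_middle_pos by metis
  then have "\<kappa> * of_real b = of_real a"
    using arg_cong[OF assms(5), of "\<lambda>p. coeff p D"] by simp
  then have "\<kappa> = of_real (a / b)" using ab by (simp add: field_simps)
  then show ?thesis using ab by (metis divide_pos_pos)
qed

lemma smult_autocorrelation:
  "smult s A * conj_rev D (smult s A) = smult (of_real ((cmod s)\<^sup>2)) (A * conj_rev D A)"
  by (simp add: conj_rev_smult complex_norm_square mult.commute del: of_real_power)

section \<open>Roots in the extended plane\<close>

lemma lin_factor_in_poly_space: "lin_factor w \<in> poly_space 1"
  by (cases w) (auto simp: poly_space_def)

lemma lin_factor_nonzero [simp]: "lin_factor w \<noteq> 0"
  by (cases w) auto

lemma lin_factor_power_in_poly_space: "lin_factor w ^ m \<in> poly_space m"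
  using poly_space_power[OF lin_factor_in_poly_space, of w m] by simp

text \<open>The constant is independent of the exponent, so a single choice serves all powers of a
  linear factor. It is 1 at 0 and infinity and \<open>- cnj a\<close> at other points \<open>a\<close>.\<close>
lemma conj_rev_lin_factor:
  "\<exists>c. c \<noteq> 0 \<and> (\<forall>m. conj_rev m (lin_factor w ^ m) = smult (c ^ m) (lin_factor (conj_inv w) ^ m))"
proof -
  have "\<exists>c. c \<noteq> 0 \<and> conj_rev 1 (lin_factor w) = smult c (lin_factor (conj_inv w))"
  proof (cases w)
    case (Fin a)
    show ?thesis
    proof (cases "a = 0")
      case True
      have "conj_rev 1 [:0, 1:] = 1"
        by (rule poly_eqI) (auto simp: coeff_conj_rev coeff_pCons split: nat.splits)
      then show ?thesis using Fin True by (intro exI[of _ 1]) simp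
    next
      case False
      have "conj_rev 1 [:-a, 1:] = [:1, - cnj a:]"
        by (rule poly_eqI) (auto simp: coeff_conj_rev coeff_pCons split: nat.splits)
      then show ?thesis using Fin False by (intro exI[of _ "- cnj a"]) simp
    qed
  next
    case Infty
    have "conj_rev 1 1 = [:0, 1:]"
      by (rule poly_eqI) (auto simp: coeff_conj_rev coeff_pCons split: nat.splits)
    then show ?thesis using Infty by (intro exI[of _ 1]) simp
  qed
  then obtain c where c: "c \<noteq> 0" "conj_rev 1 (lin_factor w) = smult c (lin_factor (conj_inv w))"
    by blast
  then show ?thesis
    using conj_rev_power[OF lin_factor_in_poly_space, of _ w]
    by (intro exI[of _ c]) (simp add: smult_power)
qed

lemma conj_inv_conj_inv: "conj_inv (conj_inv w) = w"
  by (cases w) auto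

lemma conj_inv_eq_iff_unit_circle: "conj_inv w = w \<longleftrightarrow> w \<in> unit_circle"
proof (cases w)
  case (Fin a)
  have "inverse (cnj a) = a \<longleftrightarrow> cmod a = 1" if "a \<noteq> 0"
  proof -
    have "inverse (cnj a) = a \<longleftrightarrow> a * cnj a = 1"
      using that by (auto simp: field_simps)
    also have "\<dots> \<longleftrightarrow> complex_of_real ((cmod a)\<^sup>2) = of_real 1"
      unfolding complex_norm_square by simp
    also have "\<dots> \<longleftrightarrow> (cmod a)\<^sup>2 = 1" using of_real_eq_iff by blast
    also have "\<dots> \<longleftrightarrow> cmod a = 1" by (simp add: power2_eq_1_iff) (smt (verit) norm_ge_zero)
    finally show ?thesis .
  qed
  then show ?thesis using Fin by (auto simp: unit_circle_def)
qed (auto simp: unit_circle_def)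

text \<open>This expresses multiplicity by divisibility in the graded sense, uniformly for finite
  points and infinity. At infinity the linear factor is 1, and the whole content lies in the
  degree bound of the cofactor.\<close>
lemma le_root_mult_iff:
  assumes "A \<noteq> 0" "A \<in> poly_space D"
  shows "m \<le> root_mult D A w \<longleftrightarrow>
    m \<le> D \<and> (\<exists>B\<in>poly_space (D - m). A = lin_factor w ^ m * B)"
proof (cases w)
  case (Fin a)
  have "m \<le> D \<and> degree B \<le> D - m" if "A = [:-a, 1:] ^ m * B" for B
  proof -
    have "B \<noteq> 0" using that assms(1) by auto
    then have "degree A = m + degree B"
      using that by (simp add: degree_mult_eq degree_linear_power)
    then show ?thesis using assms(2) by (auto simp: poly_space_def)
  qed
  moreover have "m \<le> order a A \<longleftrightarrow> (\<exists>B. A = [:-a, 1:] ^ m * B)"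
    using order_divides[of a m A] assms(1) by (auto simp: dvd_def)
  ultimately show ?thesis using Fin by (auto simp: poly_space_def)
qed (use assms in \<open>auto simp: poly_space_def\<close>)

lemma root_mult_mult:
  assumes "A \<noteq> 0" "A \<in> poly_space D" "B \<noteq> 0" "B \<in> poly_space E"
  shows "root_mult (D + E) (A * B) w = root_mult D A w + root_mult E B w"
  using assms by (cases w) (auto simp: order_mult degree_mult_eq poly_space_def)

text \<open>Reversing \<open>A = lin_factor w ^ m * B\<close> exhibits \<open>lin_factor (conj_inv w) ^ m\<close> as a factor of
  the reversal, so multiplicities do not decrease. Both reversal and \<open>conj_inv\<close> are involutions;
  therefore they do not increase either.\<close>
lemma root_mult_conj_rev:
  assumes "A \<noteq> 0" "A \<in> poly_space D"
  shows "root_mult D (conj_rev D A) w = root_mult D A (conj_inv w)"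
proof -
  have le: "root_mult D A w \<le> root_mult D (conj_rev D A) (conj_inv w)"
    if A: "A \<noteq> 0" "A \<in> poly_space D" for A w
  proof -
    let ?m = "root_mult D A w"
    obtain B where B: "?m \<le> D" "B \<in> poly_space (D - ?m)" "A = lin_factor w ^ ?m * B"
      using le_root_mult_iff[OF A, of ?m w] by blast
    obtain c where c: "conj_rev ?m (lin_factor w ^ ?m) = smult (c ^ ?m) (lin_factor (conj_inv w) ^ ?m)"
      using conj_rev_lin_factor by blast
    have "conj_rev D A = conj_rev (?m + (D - ?m)) (lin_factor w ^ ?m * B)"
      using B by simp
    also have "\<dots> = lin_factor (conj_inv w) ^ ?m * smult (c ^ ?m) (conj_rev (D - ?m) B)"
      using conj_rev_mult[OF lin_factor_power_in_poly_space[of w] B(2)] c by simp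
    finally have "conj_rev D A = lin_factor (conj_inv w) ^ ?m * smult (c ^ ?m) (conj_rev (D - ?m) B)" .
    moreover have "smult (c ^ ?m) (conj_rev (D - ?m) B) \<in> poly_space (D - ?m)"
      using conj_rev_in_poly_space[of "D - ?m" B] degree_smult_le[of "c ^ ?m"] order_trans
      unfolding poly_space_def by blast
    ultimately show ?thesis
      using A B(1) le_root_mult_iff[of "conj_rev D A" D ?m "conj_inv w"]
        conj_rev_in_poly_space[of D A] conj_rev_eq_0_iff[OF A(2)] by blast
  qed
  show ?thesis
  proof (rule antisym)
    show "root_mult D (conj_rev D A) w \<le> root_mult D A (conj_inv w)"
      using le[of "conj_rev D A" w] assms
      by (simp add: conj_rev_eq_0_iff conj_rev_in_poly_space conj_rev_conj_rev)
    show "root_mult D A (conj_inv w) \<le> root_mult D (conj_rev D A) w"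
      using le[OF assms, of "conj_inv w"] by (simp add: conj_inv_conj_inv)
  qed
qed

lemma root_mult_autocorrelation:
  assumes "A \<noteq> 0" "A \<in> poly_space D"
  shows "root_mult (2 * D) (A * conj_rev D A) w = root_mult D A w + root_mult D A (conj_inv w)"
  using root_mult_mult[of A D "conj_rev D A" D w] assms
  by (simp add: conj_rev_eq_0_iff conj_rev_in_poly_space root_mult_conj_rev mult_2)

lemma root_mult_eq_0:
  assumes "w \<notin> Fin ` {z. poly A z = 0}" "w \<noteq> Infty"
  shows "root_mult D A w = 0"
proof -
  obtain z where z: "w = Fin z" using assms(2) by (cases w) auto
  then have "poly A z \<noteq> 0" using assms(1) by auto
  then show ?thesis using z by (simp add: order_0I)
qed

lemma finite_roots_in_set:
  assumes "A \<noteq> 0" "{w. root_mult D A w > 0} \<subseteq> W"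
  shows "Fin ` {z. poly A z = 0} \<subseteq> W"
proof
  fix w assume "w \<in> Fin ` {z. poly A z = 0}"
  then obtain z where "w = Fin z" "poly A z = 0" by blast
  then have "root_mult D A w > 0" using assms(1) by (simp add: order_gt_0_iff)
  then show "w \<in> W" using assms(2) by blast
qed

text \<open>The fundamental theorem of algebra. The set \<open>W\<close> may contain infinity and points that are
  not roots, since their factors are 1; so one \<open>W\<close>, the set of roots of the autocorrelation, can
  serve all spectral factors.\<close>
lemma linear_factorization:
  assumes "A \<noteq> 0" "finite W" "{w. root_mult D A w > 0} \<subseteq> W"
  shows "A = smult (lead_coeff A) (\<Prod>w\<in>W. lin_factor w ^ root_mult D A w)"
proof -
  let ?Z = "{z. poly A z = 0}"
  have "(\<Prod>w\<in>W. lin_factor w ^ root_mult D A w)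
      = (\<Prod>w\<in>Fin ` ?Z. lin_factor w ^ root_mult D A w)"
  proof (rule prod.mono_neutral_right)
    show "\<forall>w\<in>W - Fin ` ?Z. lin_factor w ^ root_mult D A w = 1"
    proof
      fix w assume "w \<in> W - Fin ` ?Z"
      then show "lin_factor w ^ root_mult D A w = 1"
        by (cases "w = Infty") (simp_all add: root_mult_eq_0)
    qed
  qed (use assms(2) finite_roots_in_set[OF assms(1,3)] in auto)
  also have "\<dots> = (\<Prod>z\<in>?Z. [:-z, 1:] ^ order z A)"
    by (subst prod.reindex) (auto simp: inj_on_def)
  finally show ?thesis by (simp add: complex_poly_decompose)
qed

text \<open>The finite roots account for \<open>degree A\<close> and infinity for the remaining \<open>D - degree A\<close>.\<close>
lemma sum_root_mult:
  assumes "A \<noteq> 0" "A \<in> poly_space D" "finite W" "{w. root_mult D A w > 0} \<subseteq> W"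
  shows "(\<Sum>w\<in>W. root_mult D A w) = D"
proof -
  let ?Z = "{z. poly A z = 0}"
  have fin: "finite ?Z" using assms(1) by (rule poly_roots_finite)
  have "degree A = degree (smult (lead_coeff A) (\<Prod>z\<in>?Z. [:-z, 1:] ^ order z A))"
    by (simp add: complex_poly_decompose)
  also have "\<dots> = (\<Sum>z\<in>?Z. order z A)"
    using assms(1) by (simp add: degree_prod_eq_sum_degree degree_linear_power)
  finally have deg: "degree A = (\<Sum>z\<in>?Z. order z A)" .
  have "(\<Sum>w\<in>W. root_mult D A w) = (\<Sum>w\<in>insert Infty W. root_mult D A w)"
    using assms(3,4) by (intro sum.mono_neutral_left) auto
  also have "\<dots> = (\<Sum>w\<in>insert Infty (Fin ` ?Z). root_mult D A w)"
  proof (rule sum.mono_neutral_right)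
    show "\<forall>w\<in>insert Infty W - insert Infty (Fin ` ?Z). root_mult D A w = 0"
    proof
      fix w assume "w \<in> insert Infty W - insert Infty (Fin ` ?Z)"
      then show "root_mult D A w = 0" by (intro root_mult_eq_0) auto
    qed
  qed (use assms(3) finite_roots_in_set[OF assms(1,4)] in auto)
  also have "\<dots> = (D - degree A) + (\<Sum>w\<in>Fin ` ?Z. root_mult D A w)"
    using fin by (subst sum.insert) auto
  also have "(\<Sum>w\<in>Fin ` ?Z. root_mult D A w) = (\<Sum>z\<in>?Z. order z A)"
    by (subst sum.reindex) (auto simp: inj_on_def)
  finally show ?thesis using deg assms(2) by (simp add: poly_space_def)
qed

section \<open>Choosing roots from the root pairs\<close>

lemma root_structure_roots:
  assumes "root_structure M H P \<delta> \<mu> T \<epsilon> \<nu>"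
  shows "{w. root_mult M H w > 0} =
    (\<Union>i\<in>{1..P}. {\<delta> i, conj_inv (\<delta> i)}) \<union> (\<lambda>j. Fin (\<epsilon> j)) ` {1..T}"
proof -
  have "{w. root_mult M H w > 0} =
      {w. w \<notin> unit_circle \<and> root_mult M H w > 0} \<union> {w. w \<in> unit_circle \<and> root_mult M H w > 0}"
    by blast
  then show ?thesis using assms unfolding root_structure_def by simp
qed

lemma root_structure_location:
  assumes "root_structure M H P \<delta> \<mu> T \<epsilon> \<nu>"
  shows "i \<in> {1..P} \<Longrightarrow> \<delta> i \<notin> unit_circle" "i \<in> {1..P} \<Longrightarrow> conj_inv (\<delta> i) \<notin> unit_circle"
    "j \<in> {1..T} \<Longrightarrow> Fin (\<epsilon> j) \<in> unit_circle"
proof -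
  have "(\<Union>i\<in>{1..P}. {\<delta> i, conj_inv (\<delta> i)}) \<subseteq> - unit_circle"
    "(\<lambda>j. Fin (\<epsilon> j)) ` {1..T} \<subseteq> unit_circle"
    using assms unfolding root_structure_def by blast+
  then show "i \<in> {1..P} \<Longrightarrow> \<delta> i \<notin> unit_circle" "i \<in> {1..P} \<Longrightarrow> conj_inv (\<delta> i) \<notin> unit_circle"
    "j \<in> {1..T} \<Longrightarrow> Fin (\<epsilon> j) \<in> unit_circle" by blast+
qed

text \<open>The listing of root pairs and circle roots enumerates the roots without repetition: a
  pair has two distinct members because only points of the circle are fixed by \<open>conj_inv\<close>. The
  statement is about an arbitrary commutative monoid, as it serves both the product of the
  linear factors and the sum of the multiplicities.\<close>
lemma (in comm_monoid_set) root_structure_reindex: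
  assumes rs: "root_structure M H P \<delta> \<mu> T \<epsilon> \<nu>"
  shows "F g {w. root_mult M H w > 0} =
    F (\<lambda>i. g (\<delta> i) \<^bold>* g (conj_inv (\<delta> i))) {1..P} \<^bold>* F (\<lambda>j. g (Fin (\<epsilon> j))) {1..T}"
proof -
  let ?U = "\<Union>i\<in>{1..P}. {\<delta> i, conj_inv (\<delta> i)}"
  let ?V = "(\<lambda>j. Fin (\<epsilon> j)) ` {1..T}"
  have "?U \<subseteq> - unit_circle" "?V \<subseteq> unit_circle"
    using root_structure_location[OF rs] by blast+
  then have "?U \<inter> ?V = {}" by blast
  then have "F g (?U \<union> ?V) = F g ?U \<^bold>* F g ?V" by (intro union_disjoint) auto
  moreover have "F g ?V = F (\<lambda>j. g (Fin (\<epsilon> j))) {1..T}"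
  proof -
    have "inj_on \<epsilon> {1..T}" using rs unfolding root_structure_def by blast
    then have "inj_on (\<lambda>j. Fin (\<epsilon> j)) {1..T}" unfolding inj_on_def by blast
    then show ?thesis by (simp add: reindex o_def)
  qed
  moreover have "F g ?U = F (\<lambda>i. F g {\<delta> i, conj_inv (\<delta> i)}) {1..P}"
  proof (rule UNION_disjoint)
    have sep: "\<forall>i\<in>{1..P}. \<forall>i'\<in>{1..P}. i \<noteq> i' \<longrightarrow> \<delta> i \<noteq> \<delta> i' \<and> \<delta> i \<noteq> conj_inv (\<delta> i')"
      using rs unfolding root_structure_def by (elim conjE)
    show "\<forall>i\<in>{1..P}. \<forall>j\<in>{1..P}. i \<noteq> j \<longrightarrow>
        {\<delta> i, conj_inv (\<delta> i)} \<inter> {\<delta> j, conj_inv (\<delta> j)} = {}"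
    proof (intro ballI impI)
      fix i j assume "i \<in> {1..P}" "j \<in> {1..P}" "i \<noteq> j"
      then have "\<delta> i \<noteq> \<delta> j" "\<delta> i \<noteq> conj_inv (\<delta> j)" "\<delta> j \<noteq> conj_inv (\<delta> i)"
        using sep[rule_format, of i j] sep[rule_format, of j i] by simp_all
      moreover have "conj_inv (\<delta> i) \<noteq> conj_inv (\<delta> j)"
        using \<open>\<delta> i \<noteq> \<delta> j\<close> conj_inv_conj_inv by metis
      ultimately show "{\<delta> i, conj_inv (\<delta> i)} \<inter> {\<delta> j, conj_inv (\<delta> j)} = {}"
        by auto
    qed
  qed auto
  moreover have "F (\<lambda>i. F g {\<delta> i, conj_inv (\<delta> i)}) {1..P} =
      F (\<lambda>i. g (\<delta> i) \<^bold>* g (conj_inv (\<delta> i))) {1..P}"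
  proof (rule cong)
    fix i assume "i \<in> {1..P}"
    then have "\<delta> i \<noteq> conj_inv (\<delta> i)"
      using root_structure_location(1)[OF rs] conj_inv_eq_iff_unit_circle by metis
    then show "F g {\<delta> i, conj_inv (\<delta> i)} = g (\<delta> i) \<^bold>* g (conj_inv (\<delta> i))" by simp
  qed simp
  ultimately show ?thesis using root_structure_roots[OF rs] by simp
qed

text \<open>The polynomial, without scalar, that takes \<open>l i\<close> roots from the first member of the \<open>i\<close>-th
  root pair and the remaining ones from the second member. The bound of the space it belongs
  to does not depend on \<open>l\<close>, whereas its degree does if infinity belongs to a root pair.\<close>
definition root_choice_poly ::
  "nat \<Rightarrow> (nat \<Rightarrow> ecomplex) \<Rightarrow> (nat \<Rightarrow> nat) \<Rightarrow> nat \<Rightarrow> (nat \<Rightarrow> complex) \<Rightarrow> (nat \<Rightarrow> nat) \<Rightarrow>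
   (nat \<Rightarrow> nat) \<Rightarrow> complex poly"
  where "root_choice_poly P \<delta> \<mu> T \<epsilon> \<nu> l =
    (\<Prod>i\<in>{1..P}. lin_factor (\<delta> i) ^ l i * lin_factor (conj_inv (\<delta> i)) ^ (\<mu> i - l i)) *
    (\<Prod>j\<in>{1..T}. lin_factor (Fin (\<epsilon> j)) ^ (\<nu> j div 2))"

lemma root_choice_poly_nonzero: "root_choice_poly P \<delta> \<mu> T \<epsilon> \<nu> l \<noteq> 0"
  by (simp add: root_choice_poly_def del: lin_factor.simps)

lemma pair_factor_in_poly_space:
  assumes "a \<le> m"
  shows "lin_factor w ^ a * lin_factor w' ^ (m - a) \<in> poly_space m"
  using poly_space_mult[OF lin_factor_power_in_poly_space lin_factor_power_in_poly_space,
      of w a w' "m - a"] assms by simp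

lemma root_choice_poly_in_poly_space:
  assumes "\<And>i. i \<in> {1..P} \<Longrightarrow> l i \<le> \<mu> i"
  shows "root_choice_poly P \<delta> \<mu> T \<epsilon> \<nu> l \<in> poly_space ((\<Sum>i\<in>{1..P}. \<mu> i) + (\<Sum>j\<in>{1..T}. \<nu> j div 2))"
  unfolding root_choice_poly_def using assms
  by (intro poly_space_mult poly_space_prod pair_factor_in_poly_space
      lin_factor_power_in_poly_space) simp_all

text \<open>Reversal exchanges the members of each pair and fixes the points of the circle, so it
  sends a choice to the complementary choice.\<close>
lemma conj_rev_root_choice_poly:
  assumes l: "\<And>i. i \<in> {1..P} \<Longrightarrow> l i \<le> \<mu> i"
    and \<epsilon>: "\<And>j. j \<in> {1..T} \<Longrightarrow> Fin (\<epsilon> j) \<in> unit_circle"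
  shows "\<exists>c. c \<noteq> 0 \<and>
    conj_rev ((\<Sum>i\<in>{1..P}. \<mu> i) + (\<Sum>j\<in>{1..T}. \<nu> j div 2)) (root_choice_poly P \<delta> \<mu> T \<epsilon> \<nu> l) =
    smult c (root_choice_poly P \<delta> \<mu> T \<epsilon> \<nu> (\<lambda>i. \<mu> i - l i))"
proof -
  obtain \<kappa> where \<kappa>: "\<And>w. \<kappa> w \<noteq> 0"
    "\<And>w m. conj_rev m (lin_factor w ^ m) = smult (\<kappa> w ^ m) (lin_factor (conj_inv w) ^ m)"
    using conj_rev_lin_factor by metis
  let ?p = "\<lambda>i. lin_factor (\<delta> i) ^ l i * lin_factor (conj_inv (\<delta> i)) ^ (\<mu> i - l i)"
  let ?p' = "\<lambda>i. lin_factor (\<delta> i) ^ (\<mu> i - l i) * lin_factor (conj_inv (\<delta> i)) ^ (\<mu> i - (\<mu> i - l i))"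
  let ?q = "\<lambda>j. lin_factor (Fin (\<epsilon> j)) ^ (\<nu> j div 2)"
  let ?a = "\<lambda>i. \<kappa> (\<delta> i) ^ l i * \<kappa> (conj_inv (\<delta> i)) ^ (\<mu> i - l i)"
  let ?b = "\<lambda>j. \<kappa> (Fin (\<epsilon> j)) ^ (\<nu> j div 2)"
  have p: "conj_rev (\<mu> i) (?p i) = smult (?a i) (?p' i)" if "i \<in> {1..P}" for i
  proof -
    have "conj_rev (l i + (\<mu> i - l i)) (?p i) = smult (?a i) (?p' i)"
      using l[OF that]
      by (subst conj_rev_mult)
        (simp_all add: lin_factor_power_in_poly_space \<kappa>(2) conj_inv_conj_inv mult_ac del: lin_factor.simps)
    then show ?thesis using l[OF that] by simp
  qed
  have q: "conj_rev (\<nu> j div 2) (?q j) = smult (?b j) (?q j)" if "j \<in> {1..T}" for j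
    using \<epsilon>[OF that] conj_inv_eq_iff_unit_circle \<kappa>(2) by metis
  have "conj_rev ((\<Sum>i\<in>{1..P}. \<mu> i) + (\<Sum>j\<in>{1..T}. \<nu> j div 2)) (root_choice_poly P \<delta> \<mu> T \<epsilon> \<nu> l) =
      conj_rev (\<Sum>i\<in>{1..P}. \<mu> i) (\<Prod>i\<in>{1..P}. ?p i) *
      conj_rev (\<Sum>j\<in>{1..T}. \<nu> j div 2) (\<Prod>j\<in>{1..T}. ?q j)"
    unfolding root_choice_poly_def using l
    by (intro conj_rev_mult poly_space_prod pair_factor_in_poly_space
        lin_factor_power_in_poly_space) simp_all
  also have "conj_rev (\<Sum>i\<in>{1..P}. \<mu> i) (\<Prod>i\<in>{1..P}. ?p i) = (\<Prod>i\<in>{1..P}. conj_rev (\<mu> i) (?p i))"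
    using l by (intro conj_rev_prod pair_factor_in_poly_space) simp_all
  also have "\<dots> = smult (\<Prod>i\<in>{1..P}. ?a i) (\<Prod>i\<in>{1..P}. ?p' i)"
    unfolding prod_smult[symmetric] using p by (intro prod.cong) simp_all
  also have "conj_rev (\<Sum>j\<in>{1..T}. \<nu> j div 2) (\<Prod>j\<in>{1..T}. ?q j) =
      (\<Prod>j\<in>{1..T}. conj_rev (\<nu> j div 2) (?q j))"
    by (intro conj_rev_prod lin_factor_power_in_poly_space) simp_all
  also have "\<dots> = smult (\<Prod>j\<in>{1..T}. ?b j) (\<Prod>j\<in>{1..T}. ?q j)"
    unfolding prod_smult[symmetric] using q by (intro prod.cong) simp_all
  finally show ?thesis
    using \<kappa>(1)
    by (intro exI[of _ "(\<Prod>i\<in>{1..P}. ?a i) * (\<Prod>j\<in>{1..T}. ?b j)"])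
      (simp add: root_choice_poly_def mult_ac del: lin_factor.simps)
qed

text \<open>The right-hand side does not contain \<open>l\<close>: together, complementary choices use both members
  of each pair with the full multiplicity.\<close>
lemma root_choice_poly_mult_flip:
  assumes "\<And>i. i \<in> {1..P} \<Longrightarrow> l i \<le> \<mu> i"
  shows "root_choice_poly P \<delta> \<mu> T \<epsilon> \<nu> l * root_choice_poly P \<delta> \<mu> T \<epsilon> \<nu> (\<lambda>i. \<mu> i - l i) =
    (\<Prod>i\<in>{1..P}. (lin_factor (\<delta> i) * lin_factor (conj_inv (\<delta> i))) ^ \<mu> i) *
    (\<Prod>j\<in>{1..T}. lin_factor (Fin (\<epsilon> j)) ^ (\<nu> j div 2))\<^sup>2"
proof -
  let ?p = "\<lambda>l i. lin_factor (\<delta> i) ^ l i * lin_factor (conj_inv (\<delta> i)) ^ (\<mu> i - l i)"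
  have pair: "?p l i * ?p (\<lambda>i. \<mu> i - l i) i = (lin_factor (\<delta> i) * lin_factor (conj_inv (\<delta> i))) ^ \<mu> i"
    if "i \<in> {1..P}" for i
  proof -
    have "?p l i * ?p (\<lambda>i. \<mu> i - l i) i =
        lin_factor (\<delta> i) ^ (l i + (\<mu> i - l i)) * lin_factor (conj_inv (\<delta> i)) ^ ((\<mu> i - l i) + l i)"
      using assms[OF that] by (simp only: power_add diff_diff_cancel mult_ac)
    then show ?thesis using assms[OF that] by (simp add: power_mult_distrib del: lin_factor.simps)
  qed
  have "(\<Prod>i\<in>{1..P}. ?p l i) * (\<Prod>i\<in>{1..P}. ?p (\<lambda>i. \<mu> i - l i) i) =
      (\<Prod>i\<in>{1..P}. (lin_factor (\<delta> i) * lin_factor (conj_inv (\<delta> i))) ^ \<mu> i)"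
    unfolding prod.distrib[symmetric] by (intro prod.cong refl pair)
  from this[symmetric] show ?thesis
    unfolding root_choice_poly_def power2_eq_square by (simp only: mult_ac)
qed

text \<open>The multiplicities of \<open>S\<close> at the two members of a pair add up to that of the
  autocorrelation, and on the circle the two summands coincide, which also makes \<open>\<nu> j\<close> even. The
  second statement counts the roots of \<open>S\<close>; it ties the degree bound of the choices to \<open>D\<close>.\<close>
lemma spectral_factor_is_root_choice:
  assumes S: "S \<noteq> 0" "S \<in> poly_space D"
    and rs: "root_structure (2 * D) (S * conj_rev D S) P \<delta> \<mu> T \<epsilon> \<nu>"
  shows "\<exists>l \<in> \<Pi>\<^sub>E i\<in>{1..P}. {0..\<mu> i}.
      S = smult (lead_coeff S) (root_choice_poly P \<delta> \<mu> T \<epsilon> \<nu> l)"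
    and "(\<Sum>i\<in>{1..P}. \<mu> i) + (\<Sum>j\<in>{1..T}. \<nu> j div 2) = D"
proof -
  define W where "W = {w. root_mult (2 * D) (S * conj_rev D S) w > 0}"
  have "finite W" unfolding W_def root_structure_roots[OF rs] by simp
  have sub: "{w. root_mult D S w > 0} \<subseteq> W"
    unfolding W_def by (auto simp: root_mult_autocorrelation[OF S])
  have "\<forall>i\<in>{1..P}. root_mult (2 * D) (S * conj_rev D S) (\<delta> i) = \<mu> i"
    using rs unfolding root_structure_def by (elim conjE)
  then have "root_mult D S (\<delta> i) + root_mult D S (conj_inv (\<delta> i)) = \<mu> i" if "i \<in> {1..P}" for i
    using that root_mult_autocorrelation[OF S] by simp
  then have \<mu>: "root_mult D S (conj_inv (\<delta> i)) = \<mu> i - root_mult D S (\<delta> i)"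
      "root_mult D S (\<delta> i) \<le> \<mu> i" if "i \<in> {1..P}" for i
    using that by (metis add_diff_cancel_left', metis le_add1)
  have \<nu>: "root_mult D S (Fin (\<epsilon> j)) = \<nu> j div 2" if "j \<in> {1..T}" for j
  proof -
    have "\<forall>j\<in>{1..T}. root_mult (2 * D) (S * conj_rev D S) (Fin (\<epsilon> j)) = \<nu> j"
      using rs unfolding root_structure_def by (elim conjE)
    moreover have "conj_inv (Fin (\<epsilon> j)) = Fin (\<epsilon> j)"
      using root_structure_location(3)[OF rs that] conj_inv_eq_iff_unit_circle by blast
    ultimately have "2 * root_mult D S (Fin (\<epsilon> j)) = \<nu> j"
      using that root_mult_autocorrelation[OF S] by (metis mult_2)
    then show ?thesis by linarith
  qed
  define l where "l = restrict (\<lambda>i. root_mult D S (\<delta> i)) {1..P}"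
  have "l \<in> (\<Pi>\<^sub>E i\<in>{1..P}. {0..\<mu> i})"
    using \<mu>(2) by (auto simp: l_def)
  moreover have "(\<Prod>w\<in>W. lin_factor w ^ root_mult D S w) = root_choice_poly P \<delta> \<mu> T \<epsilon> \<nu> l"
    unfolding W_def prod.root_structure_reindex[OF rs] root_choice_poly_def
    by (intro arg_cong2[where f = "(*)"] prod.cong) (simp_all add: \<mu> \<nu> l_def del: lin_factor.simps root_mult.simps)
  ultimately show "\<exists>l \<in> \<Pi>\<^sub>E i\<in>{1..P}. {0..\<mu> i}.
      S = smult (lead_coeff S) (root_choice_poly P \<delta> \<mu> T \<epsilon> \<nu> l)"
    using linear_factorization[OF S(1) \<open>finite W\<close> sub] by metis
  have "(\<Sum>w\<in>W. root_mult D S w) = (\<Sum>i\<in>{1..P}. \<mu> i) + (\<Sum>j\<in>{1..T}. \<nu> j div 2)"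
    unfolding W_def sum.root_structure_reindex[OF rs]
    by (intro arg_cong2[where f = "(+)"] sum.cong) (simp_all add: \<mu> \<nu> del: root_mult.simps)
  then show "(\<Sum>i\<in>{1..P}. \<mu> i) + (\<Sum>j\<in>{1..T}. \<nu> j div 2) = D"
    using sum_root_mult[OF S \<open>finite W\<close> sub] by simp
qed

text \<open>Both \<open>Q\<close> and the given choice have autocorrelations proportional to the same polynomial
  \<open>G\<close>, namely the product of a choice with its complement.\<close>
lemma normalized_root_choice:
  assumes Q: "Q \<noteq> 0" "Q \<in> poly_space D"
    and rs: "root_structure (2 * D) (Q * conj_rev D Q) P \<delta> \<mu> T \<epsilon> \<nu>"
    and l: "l \<in> (\<Pi>\<^sub>E i\<in>{1..P}. {0..\<mu> i})"
  shows "\<exists>c>0. smult (complex_of_real c) (root_choice_poly P \<delta> \<mu> T \<epsilon> \<nu> l) *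
      conj_rev D (smult (complex_of_real c) (root_choice_poly P \<delta> \<mu> T \<epsilon> \<nu> l)) = Q * conj_rev D Q"
proof -
  let ?F = "root_choice_poly P \<delta> \<mu> T \<epsilon> \<nu>"
  define G where "G = (\<Prod>i\<in>{1..P}. (lin_factor (\<delta> i) * lin_factor (conj_inv (\<delta> i))) ^ \<mu> i) *
    (\<Prod>j\<in>{1..T}. lin_factor (Fin (\<epsilon> j)) ^ (\<nu> j div 2))\<^sup>2"
  note D = spectral_factor_is_root_choice(2)[OF Q rs]
  have F: "?F l \<in> poly_space D \<and> (\<exists>c. c \<noteq> 0 \<and> ?F l * conj_rev D (?F l) = smult c G)"
    if "l \<in> (\<Pi>\<^sub>E i\<in>{1..P}. {0..\<mu> i})" for l
  proof -
    have le: "l i \<le> \<mu> i" if "i \<in> {1..P}" for i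
      using \<open>l \<in> _\<close> that by (auto simp: PiE_iff)
    obtain c where c: "c \<noteq> 0" "conj_rev D (?F l) = smult c (?F (\<lambda>i. \<mu> i - l i))"
      using conj_rev_root_choice_poly[of P l \<mu> T \<epsilon>] le root_structure_location(3)[OF rs] D by metis
    then have "?F l * conj_rev D (?F l) = smult c G"
      unfolding G_def using root_choice_poly_mult_flip[of P l \<mu>] le by simp
    then show ?thesis using c(1) root_choice_poly_in_poly_space[of P l \<mu>] le D by blast
  qed
  \<comment> \<open>\<open>Q\<close> is itself a spectral factor of \<open>H\<close>, hence a choice of roots.\<close>
  obtain l0 s where l0: "l0 \<in> (\<Pi>\<^sub>E i\<in>{1..P}. {0..\<mu> i})" "Q = smult s (?F l0)"
    using spectral_factor_is_root_choice(1)[OF Q rs] by blast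
  obtain c0 where c0: "c0 \<noteq> 0" "?F l0 * conj_rev D (?F l0) = smult c0 G"
    using F[OF l0(1)] by blast
  obtain c where c: "c \<noteq> 0" "?F l * conj_rev D (?F l) = smult c G"
    using F[OF l] by blast
  have H: "Q * conj_rev D Q = smult (of_real ((cmod s)\<^sup>2) * c0) G"
    unfolding l0(2) smult_autocorrelation c0(2) by simp
  have "s \<noteq> 0" using l0(2) Q(1) by auto
  then have "Q * conj_rev D Q = smult (of_real ((cmod s)\<^sup>2) * c0 / c) (?F l * conj_rev D (?F l))"
    unfolding H c(2) using c(1) by simp
  then obtain r where r: "r > 0" "Q * conj_rev D Q = smult (of_real r) (?F l * conj_rev D (?F l))"
    using proportional_autocorrelation_pos[OF Q(2,1)] F[OF l] root_choice_poly_nonzero by metis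
  then show ?thesis
    \<comment> \<open>A scalar enters the autocorrelation through its squared modulus.\<close>
    by (intro exI[of _ "sqrt r"]) (simp only: smult_autocorrelation, simp)
qed

text \<open>Two proportional polynomials with the same nonzero autocorrelation differ by a factor of
  modulus 1, so for each \<open>l\<close> the normalized choice is unique up to \<open>\<beta>\<close>.\<close>
theorem spectral_factors:
  assumes Q: "Q \<noteq> 0" "Q \<in> poly_space D"
    and rs: "root_structure (2 * D) (Q * conj_rev D Q) P \<delta> \<mu> T \<epsilon> \<nu>"
  shows "\<exists>c :: (nat \<Rightarrow> nat) \<Rightarrow> real.
    (\<forall>l \<in> (\<Pi>\<^sub>E i\<in>{1..P}. {0..\<mu> i}). c l > 0) \<and>
    (\<forall>S. S \<in> poly_space D \<and> S * conj_rev D S = Q * conj_rev D Q \<longleftrightarrow>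
      (\<exists>\<beta>. \<exists>l \<in> (\<Pi>\<^sub>E i\<in>{1..P}. {0..\<mu> i}). cmod \<beta> = 1 \<and>
        S = smult \<beta> (smult (complex_of_real (c l)) (root_choice_poly P \<delta> \<mu> T \<epsilon> \<nu> l))))"
proof -
  let ?L = "\<Pi>\<^sub>E i\<in>{1..P}. {0..\<mu> i}"
  let ?F = "root_choice_poly P \<delta> \<mu> T \<epsilon> \<nu>"
  let ?H = "Q * conj_rev D Q"
  have "\<forall>l\<in>?L. \<exists>c>0. smult (complex_of_real c) (?F l) * conj_rev D (smult (complex_of_real c) (?F l)) = ?H"
    using normalized_root_choice[OF Q rs] by blast
  then obtain c where c: "\<And>l. l \<in> ?L \<Longrightarrow> c l > 0"
    "\<And>l. l \<in> ?L \<Longrightarrow> smult (complex_of_real (c l)) (?F l) * conj_rev D (smult (complex_of_real (c l)) (?F l)) = ?H"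
    by metis
  have "S \<in> poly_space D \<and> S * conj_rev D S = ?H \<longleftrightarrow>
      (\<exists>\<beta>. \<exists>l\<in>?L. cmod \<beta> = 1 \<and> S = smult \<beta> (smult (complex_of_real (c l)) (?F l)))" for S
  proof safe
    assume S: "S \<in> poly_space D" "S * conj_rev D S = ?H"
    have "?H \<noteq> 0" using Q conj_rev_eq_0_iff by simp
    then have "S \<noteq> 0" using S(2) by auto
    obtain l where l: "l \<in> ?L" "S = smult (lead_coeff S) (?F l)"
      using spectral_factor_is_root_choice(1)[OF \<open>S \<noteq> 0\<close> S(1)] S(2) rs by metis
    define s where "s = lead_coeff S"
    have "smult (of_real ((cmod s)\<^sup>2)) (?F l * conj_rev D (?F l)) = ?H"
      using S(2) l(2) smult_autocorrelation unfolding s_def by metis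
    moreover have "smult (of_real ((c l)\<^sup>2)) (?F l * conj_rev D (?F l)) = ?H"
      using c(2)[OF l(1)] by (simp only: smult_autocorrelation) simp
    moreover have "?F l * conj_rev D (?F l) \<noteq> 0"
      using calculation \<open>?H \<noteq> 0\<close> by auto
    ultimately have "smult (complex_of_real ((cmod s)\<^sup>2) - of_real ((c l)\<^sup>2)) (?F l * conj_rev D (?F l)) = 0"
      "?F l * conj_rev D (?F l) \<noteq> 0"
      by (simp_all only: smult_diff_left, simp_all)
    then have "complex_of_real ((cmod s)\<^sup>2) = of_real ((c l)\<^sup>2)"
      by (simp only: smult_eq_0_iff) simp
    then have "(cmod s)\<^sup>2 = (c l)\<^sup>2" using of_real_eq_iff by blast
    then have "cmod s = c l" using c(1)[OF l(1)] by (simp add: power2_eq_iff_nonneg)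
    then have "cmod (s / of_real (c l)) = 1" "s = s / of_real (c l) * of_real (c l)"
      using c(1)[OF l(1)] by (auto simp: norm_divide)
    then show "\<exists>\<beta>. \<exists>l\<in>?L. cmod \<beta> = 1 \<and> S = smult \<beta> (smult (complex_of_real (c l)) (?F l))"
      using l unfolding s_def by (metis smult_smult)
  next
    fix \<beta> l assume l: "l \<in> ?L" and \<beta>: "cmod \<beta> = 1"
    let ?S = "smult \<beta> (smult (complex_of_real (c l)) (?F l))"
    show "?S * conj_rev D ?S = ?H"
      using \<beta> c(2)[OF l] by (subst smult_autocorrelation) simp
    have "?F l \<in> poly_space ((\<Sum>i\<in>{1..P}. \<mu> i) + (\<Sum>j\<in>{1..T}. \<nu> j div 2))"
      using l by (intro root_choice_poly_in_poly_space) (auto simp: PiE_iff)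
    then have "?F l \<in> poly_space D"
      unfolding spectral_factor_is_root_choice(2)[OF Q rs] .
    then show "?S \<in> poly_space D" by (simp add: poly_space_def)
  qed
  then show ?thesis using c(1) by blast
qed

section \<open>Families with the same correlations\<close>

text \<open>A common root \<open>w\<close> of the quotients would make \<open>Q * lin_factor w\<close> a common divisor of bound
  \<open>D + 1\<close>. For \<open>w\<close> at infinity the polynomial stays the same and only the bound increases. A
  quotient that is zero vanishes everywhere, hence the condition \<open>R k \<noteq> 0\<close>.\<close>
lemma gcd_quotients_no_common_root:
  assumes gcd: "is_gcd D Q M (X ` I)" and "I \<noteq> {}" and nz: "\<exists>k\<in>I. X k \<noteq> 0"
    and R: "\<And>k. k \<in> I \<Longrightarrow> R k \<in> poly_space (M - D)" "\<And>k. k \<in> I \<Longrightarrow> X k = Q * R k"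
  shows "\<exists>k\<in>I. R k \<noteq> 0 \<and> root_mult (M - D) (R k) w = 0"
proof (rule ccontr)
  assume "\<not> ?thesis"
  then have common: "R k \<noteq> 0 \<Longrightarrow> 1 \<le> root_mult (M - D) (R k) w" if "k \<in> I" for k
    using that by (meson less_one not_le)
  have factor: "1 \<le> M - D \<and> (\<exists>B\<in>poly_space (M - D - 1). R k = lin_factor w * B)"
    if "k \<in> I" "R k \<noteq> 0" for k
    using common[OF that] le_root_mult_iff[OF that(2) R(1)[OF that(1)], of 1 w] by simp
  have Q: "Q \<noteq> 0" "Q \<in> poly_space D"
    using gcd \<open>I \<noteq> {}\<close> unfolding is_gcd_def space_dvd_def by auto
  have "D + 1 \<le> M" using nz R(2) factor by fastforce
  have "space_dvd (D + 1) (Q * lin_factor w) M (X k)" if k: "k \<in> I" for k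
  proof -
    have "X k \<in> poly_space M" using gcd k unfolding is_gcd_def space_dvd_def by auto
    moreover have "\<exists>B\<in>poly_space (M - (D + 1)). X k = B * (Q * lin_factor w)"
    proof (cases "R k = 0")
      case True
      then show ?thesis using R(2)[OF k] by (intro bexI[of _ 0]) (auto simp: poly_space_def)
    next
      case False
      then obtain B where "B \<in> poly_space (M - (D + 1))" "R k = lin_factor w * B"
        using factor[OF k] by auto
      then show ?thesis using R(2)[OF k] by (intro bexI[of _ B]) (simp_all add: mult_ac)
    qed
    ultimately show ?thesis
      using \<open>D + 1 \<le> M\<close> Q poly_space_mult[OF Q(2) lin_factor_in_poly_space]
      unfolding space_dvd_def by simp
  qed
  then have "D + 1 \<le> D" using gcd unfolding is_gcd_def by blast
  then show False by simp
qed

text \<open>The polynomial \<open>V\<close> divides every \<open>R k * W\<close>, hence their greatest common divisor, which is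
  \<open>W\<close> up to a unit because the \<open>R k\<close> are coprime.\<close>
lemma proportional_family_factors:
  fixes R Y :: "'i \<Rightarrow> complex poly"
  assumes "finite I" "V \<noteq> 0"
    and no_root: "\<And>a. \<exists>k\<in>I. poly (R k) a \<noteq> 0"
    and eq: "\<And>k. k \<in> I \<Longrightarrow> Y k * V = R k * W"
  shows "\<exists>S. W = S * V \<and> (\<forall>k\<in>I. Y k = S * R k)"
proof -
  have "is_unit (Gcd_fin (R ` I))"
  proof (rule ccontr)
    assume nu: "\<not> is_unit (Gcd_fin (R ` I))"
    obtain k where "k \<in> I" "R k \<noteq> 0" using no_root[of 0] by (metis poly_0)
    then have "Gcd_fin (R ` I) \<noteq> 0" using assms(1) by auto
    then have "degree (Gcd_fin (R ` I)) \<noteq> 0" using nu is_unit_iff_degree by blast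
    then obtain a where "poly (Gcd_fin (R ` I)) a = 0"
      using fundamental_theorem_of_algebra constant_degree by metis
    then have "poly (R k) a = 0" if "k \<in> I" for k
      using that Gcd_fin_dvd[of "R k" "R ` I"] by (auto elim!: dvdE)
    then show False using no_root[of a] by blast
  qed
  have "V dvd Gcd_fin ((*) W ` R ` I)"
    using assms(1) eq by (subst dvd_Gcd_fin_iff) (auto simp: mult.commute[of W] eq[symmetric])
  then have "V dvd W * Gcd_fin (R ` I)"
    unfolding Gcd_fin_mult[OF finite_imageI[OF assms(1)]] dvd_normalize_iff .
  then have "V dvd W" using \<open>is_unit _\<close> by (simp add: dvd_mult_unit_iff)
  then obtain S where S: "W = S * V" by (metis dvd_div_mult_self)
  have "Y k = S * R k" if "k \<in> I" for k
    using eq[OF that] \<open>V \<noteq> 0\<close> unfolding S by (simp add: mult_ac)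
  then show ?thesis using S by blast
qed

text \<open>The hypothesis \<open>no_root\<close> is used twice: at the finite points it gives the factor \<open>S\<close>, and at
  infinity it bounds the degree of \<open>S\<close>.\<close>
theorem same_correlations_iff_spectral_factor:
  assumes "D \<le> M" and Q: "Q \<noteq> 0" "Q \<in> poly_space D" and "finite I" and nz: "\<exists>k\<in>I. R k \<noteq> 0"
    and R: "\<And>k. k \<in> I \<Longrightarrow> R k \<in> poly_space (M - D)"
    and no_root: "\<And>w. \<exists>k\<in>I. R k \<noteq> 0 \<and> root_mult (M - D) (R k) w = 0"
  shows "(\<forall>k\<in>I. Y k \<in> poly_space M) \<and>
      (\<forall>i\<in>I. \<forall>j\<in>I. (Q * R i) * conj_rev M (Q * R j) = Y i * conj_rev M (Y j)) \<longleftrightarrow>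
    (\<exists>S. S \<in> poly_space D \<and> S * conj_rev D S = Q * conj_rev D Q \<and> (\<forall>k\<in>I. Y k = S * R k))"
proof -
  have M: "D + (M - D) = M" using \<open>D \<le> M\<close> by simp
  have conj_rev_split: "conj_rev M (A * R k) = conj_rev D A * conj_rev (M - D) (R k)"
    and space: "A * R k \<in> poly_space M" if "A \<in> poly_space D" "k \<in> I" for A k
    using conj_rev_mult[OF that(1) R[OF that(2)]] poly_space_mult[OF that(1) R[OF that(2)]] M
    by simp_all
  show ?thesis
  proof (intro iffI conjI ballI; (elim conjE exE)?)
    assume Y: "\<forall>k\<in>I. Y k \<in> poly_space M"
      and eq: "\<forall>i\<in>I. \<forall>j\<in>I. (Q * R i) * conj_rev M (Q * R j) = Y i * conj_rev M (Y j)"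
    \<comment> \<open>Column \<open>j\<close> of the correlations has the common nonzero multiplier \<open>conj_rev M (Y j)\<close>.\<close>
    obtain j where j: "j \<in> I" "R j \<noteq> 0" using nz by blast
    then have V: "conj_rev M (Y j) \<noteq> 0"
      using eq Q conj_rev_eq_0_iff[OF space[OF Q(2) j(1)]]
      by (metis mult_eq_0_iff)
    have "\<exists>S. Q * conj_rev M (Q * R j) = S * conj_rev M (Y j) \<and> (\<forall>k\<in>I. Y k = S * R k)"
    proof (rule proportional_family_factors[OF \<open>finite I\<close> V])
      show "\<exists>k\<in>I. poly (R k) a \<noteq> 0" for a
        using no_root[of "Fin a"] by (auto simp: order_root)
      show "Y k * conj_rev M (Y j) = R k * (Q * conj_rev M (Q * R j))" if "k \<in> I" for k
        using eq[rule_format, OF that j(1)] by (simp only: mult_ac)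
    qed
    then obtain S where S: "\<And>k. k \<in> I \<Longrightarrow> Y k = S * R k" by blast
    have "S \<in> poly_space D"
    proof (cases "S = 0")
      case False
      \<comment> \<open>An \<open>R k\<close> without root at infinity has full degree, so the bound on \<open>Y k\<close> transfers to \<open>S\<close>.\<close>
      obtain k where k: "k \<in> I" "R k \<noteq> 0" "root_mult (M - D) (R k) Infty = 0"
        using no_root by blast
      then have "degree (R k) = M - D" using R[of k] by (simp add: poly_space_def)
      then have "degree (Y k) = degree S + (M - D)" using S[OF k(1)] k(2) False by (simp add: degree_mult_eq)
      then show ?thesis using Y k(1) M by (fastforce simp: poly_space_def)
    qed (simp add: poly_space_def)
    moreover have "S * conj_rev D S = Q * conj_rev D Q"
    proof -
      have "(Q * R j) * conj_rev M (Q * R j) = (S * R j) * conj_rev M (S * R j)"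
        using eq[rule_format, OF j(1) j(1)] unfolding S[OF j(1)] .
      then have "(R j * conj_rev (M - D) (R j)) * (S * conj_rev D S) =
          (R j * conj_rev (M - D) (R j)) * (Q * conj_rev D Q)"
        unfolding conj_rev_split[OF Q(2) j(1)] conj_rev_split[OF \<open>S \<in> poly_space D\<close> j(1)] by (simp only: mult_ac)
      moreover have "R j * conj_rev (M - D) (R j) \<noteq> 0"
        using j(2) conj_rev_eq_0_iff[OF R[OF j(1)]] by simp
      ultimately show ?thesis using mult_left_cancel by blast
    qed
    ultimately show "\<exists>S. S \<in> poly_space D \<and> S * conj_rev D S = Q * conj_rev D Q \<and> (\<forall>k\<in>I. Y k = S * R k)"
      using S by blast
  next
    fix S k assume "S \<in> poly_space D" "\<forall>k\<in>I. Y k = S * R k" "k \<in> I"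
    then show "Y k \<in> poly_space M" using space by simp
  next
    fix S i j assume S: "S \<in> poly_space D" "S * conj_rev D S = Q * conj_rev D Q"
      "\<forall>k\<in>I. Y k = S * R k" and ij: "i \<in> I" "j \<in> I"
    have "(Q * R i) * conj_rev M (Q * R j) = (Q * conj_rev D Q) * (R i * conj_rev (M - D) (R j))"
      unfolding conj_rev_split[OF Q(2) ij(2)] by (simp only: mult_ac)
    also have "\<dots> = (S * R i) * conj_rev M (S * R j)"
      unfolding conj_rev_split[OF S(1) ij(2)] S(2)[symmetric] by (simp only: mult_ac)
    finally show "(Q * R i) * conj_rev M (Q * R j) = Y i * conj_rev M (Y j)"
      using S(3) ij by simp
  qed
qed

theorem theorem29:
  fixes N K D P T :: nat
    and X R :: "nat \<Rightarrow> complex poly"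
    and Q :: "complex poly"
    and \<delta> :: "nat \<Rightarrow> ecomplex" and \<epsilon> :: "nat \<Rightarrow> complex"
    and \<mu> \<nu> :: "nat \<Rightarrow> nat"
  assumes "N \<ge> 1" and "K \<ge> 1"
    and "\<forall>k\<in>{1..K}. X k \<in> poly_space (N - 1)"
    and "\<exists>k\<in>{1..K}. X k \<noteq> 0"
    and "is_gcd D Q (N - 1) (X ` {1..K})"
    and "\<forall>k\<in>{1..K}. R k \<in> poly_space (N - D - 1) \<and> X k = Q * R k"
    and "root_structure (2 * D) (Q * conj_rev D Q) P \<delta> \<mu> T \<epsilon> \<nu>"
  shows "\<exists>c :: (nat \<Rightarrow> nat) \<Rightarrow> real.
    (\<forall>l \<in> (\<Pi>\<^sub>E i\<in>{1..P}. {0..\<mu> i}). c l > 0) \<and>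
    (\<forall>Y :: nat \<Rightarrow> complex poly.
      (\<forall>k\<in>{1..K}. Y k \<in> poly_space (N - 1)) \<and>
      (\<forall>i\<in>{1..K}. \<forall>j\<in>{1..K}. Gamma N X i j = Gamma N Y i j)
      \<longleftrightarrow>
      (\<exists>\<beta> :: complex. \<exists>l \<in> (\<Pi>\<^sub>E i\<in>{1..P}. {0..\<mu> i}). \<exists>S.
        cmod \<beta> = 1 \<and>
        S = smult (complex_of_real (c l))
              ((\<Prod>i\<in>{1..P}. lin_factor (\<delta> i) ^ l i * lin_factor (conj_inv (\<delta> i)) ^ (\<mu> i - l i)) *
               (\<Prod>j\<in>{1..T}. lin_factor (Fin (\<epsilon> j)) ^ (\<nu> j div 2))) \<and>
        (\<forall>k\<in>{1..K}. Y k = smult \<beta> (S * R k))))"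
proof -
  define M where "M = N - 1"
  let ?I = "{1..K}"
  let ?L = "\<Pi>\<^sub>E i\<in>{1..P}. {0..\<mu> i}"
  have gcd: "is_gcd D Q M (X ` ?I)" using assms(5) by (simp add: M_def)
  have R: "R k \<in> poly_space (M - D)" "X k = Q * R k" if "k \<in> ?I" for k
    using assms(6) that by (auto simp: M_def add.commute)
  have "?I \<noteq> {}" using assms(2) by simp
  then have Q: "Q \<noteq> 0" "Q \<in> poly_space D" "D \<le> M"
    using gcd unfolding is_gcd_def space_dvd_def by auto
  have no_root: "\<exists>k\<in>?I. R k \<noteq> 0 \<and> root_mult (M - D) (R k) w = 0" for w
    using gcd_quotients_no_common_root[OF gcd \<open>?I \<noteq> {}\<close> assms(4)] R by blast
  then have nz: "\<exists>k\<in>?I. R k \<noteq> 0" by blast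
  obtain c where c: "\<forall>l\<in>?L. c l > 0"
    and factors: "\<And>S. S \<in> poly_space D \<and> S * conj_rev D S = Q * conj_rev D Q \<longleftrightarrow>
      (\<exists>\<beta>. \<exists>l\<in>?L. cmod \<beta> = 1 \<and>
        S = smult \<beta> (smult (complex_of_real (c l)) (root_choice_poly P \<delta> \<mu> T \<epsilon> \<nu> l)))"
    using spectral_factors[OF Q(1,2) assms(7)] by blast
  have "(\<forall>k\<in>?I. Y k \<in> poly_space (N - 1)) \<and> (\<forall>i\<in>?I. \<forall>j\<in>?I. Gamma N X i j = Gamma N Y i j) \<longleftrightarrow>
      (\<exists>\<beta>. \<exists>l\<in>?L. \<exists>S. cmod \<beta> = 1 \<and>
        S = smult (complex_of_real (c l)) (root_choice_poly P \<delta> \<mu> T \<epsilon> \<nu> l) \<and>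
        (\<forall>k\<in>?I. Y k = smult \<beta> (S * R k)))" (is "?lhs \<longleftrightarrow> ?rhs") for Y
  proof -
    have "?lhs \<longleftrightarrow> (\<forall>k\<in>?I. Y k \<in> poly_space M) \<and>
        (\<forall>i\<in>?I. \<forall>j\<in>?I. (Q * R i) * conj_rev M (Q * R j) = Y i * conj_rev M (Y j))"
      using R(2) unfolding Gamma_def M_def by simp
    also have "\<dots> \<longleftrightarrow> (\<exists>S. S \<in> poly_space D \<and> S * conj_rev D S = Q * conj_rev D Q \<and>
        (\<forall>k\<in>?I. Y k = S * R k))"
      by (rule same_correlations_iff_spectral_factor[OF Q(3,1,2) _ nz R(1) no_root]) simp_all
    also have "\<dots> \<longleftrightarrow> (\<exists>S. (\<exists>\<beta>. \<exists>l\<in>?L. cmod \<beta> = 1 \<and>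
        S = smult \<beta> (smult (complex_of_real (c l)) (root_choice_poly P \<delta> \<mu> T \<epsilon> \<nu> l))) \<and>
        (\<forall>k\<in>?I. Y k = S * R k))"
      using factors by blast
    also have "\<dots> \<longleftrightarrow> ?rhs"
      unfolding mult_smult_left[symmetric] by blast
    finally show ?thesis .
  qed
  then show ?thesis
    using c unfolding root_choice_poly_def by blast
qed

end
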